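(* Let $X$ and $Y$ be two independent positive random variables with positive and continuously differentiable densities on $(0,\infty)$. Suppose that $$U=\frac{Y}{1+X},\qquad V=X\left(1+\frac{Y}{1+X}\right)$$ are independent. Then there exist constants $a,b,c>0$ such that $X\sim\mathcal{K}(a,b-a,c)$ and $Y\sim\mathcal{G}(b,c)$ or, equivalently, $U\sim\mathcal{K}(b,a-b,c)$ and $V\sim\mathcal{G}(a,c)$.
   Context: For $\alpha,\gamma>0$ and $\beta\in\mathbb{R}$, the Kummer distribution $\mathcal{K}(\alpha,\beta,\gamma)$ is the probability distribution on $(0,\infty)$ with density proportional to $\frac{x^{\alpha-1}}{(1+x)^{\alpha+\beta}}e^{-\gamma x}\mathbf{1}_{(0,\infty)}(x)$. For $\alpha,\gamma>0$, the Gamma distribution $\mathcal{G}(\alpha,\gamma)$ is the probability distribution with density proportional to $x^{\alpha-1}e^{-\gamma x}\mathbf{1}_{(0,\infty)}(x)$. *)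

theory Defs
  imports "HOL-Probability.Probability"
begin

text \<open>For an integrable nonnegative kernel \<open>k\<close> of positive total mass, this is the probability
  measure whose density is proportional to \<open>k\<close>.\<close>

definition normalised_measure :: "(real \<Rightarrow> real) \<Rightarrow> real measure" where
  "normalised_measure k = density lborel (\<lambda>x. ennreal (k x / (\<integral>y. k y \<partial>lborel)))"

text \<open>Both kernels below are integrable when the first and the last parameter are positive; the
  distributions are only meaningful in that range.\<close>

definition kummer_kernel :: "real \<Rightarrow> real \<Rightarrow> real \<Rightarrow> real \<Rightarrow> real" where
  "kummer_kernel \<alpha> \<beta> \<gamma> x =
     x powr (\<alpha> - 1) / (1 + x) powr (\<alpha> + \<beta>) * exp (- \<gamma> * x) * indicator {0<..} x"

definition kummer_distribution :: "real \<Rightarrow> real \<Rightarrow> real \<Rightarrow> real measure" where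
  "kummer_distribution \<alpha> \<beta> \<gamma> = normalised_measure (kummer_kernel \<alpha> \<beta> \<gamma>)"

definition gamma_kernel :: "real \<Rightarrow> real \<Rightarrow> real \<Rightarrow> real" where
  "gamma_kernel \<alpha> \<gamma> x = x powr (\<alpha> - 1) * exp (- \<gamma> * x) * indicator {0<..} x"

definition gamma_distribution :: "real \<Rightarrow> real \<Rightarrow> real measure" where
  "gamma_distribution \<alpha> \<gamma> = normalised_measure (gamma_kernel \<alpha> \<gamma>)"

text \<open>The measurable space in \<open>distr\<close> is \<open>lborel\<close>, i.e. the Borel sets.\<close>

definition has_law :: "'a measure \<Rightarrow> ('a \<Rightarrow> real) \<Rightarrow> real measure \<Rightarrow> bool" where
  "has_law M X \<mu> \<longleftrightarrow> X \<in> borel_measurable M \<and> distr M lborel X = \<mu>"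

end

theory Submission
  imports Defs "HOL-Real_Asymp.Real_Asymp"
begin

text \<open>The map \<open>(x, y) \<mapsto> (u, v) = (y / (1 + x), x (1 + u))\<close> is an involution of the open quadrant with
  Jacobian \<open>(1 + u) / (1 + x)\<close>. Independence of \<open>U\<close> and \<open>V\<close> therefore says that
  \<open>f x * g y * (1 + x) / (1 + u)\<close> is a product of a function of \<open>u\<close> and a function of \<open>v\<close>. Taking
  logarithms and differentiating in \<open>x\<close> at fixed \<open>u\<close> removes the function of \<open>u\<close> and leaves
  \<open>\<alpha> x + u \<beta> (u (1 + x)) = (1 + u) \<delta> (x (1 + u))\<close> with continuous \<open>\<beta>\<close> and \<open>\<delta>\<close>. Letting \<open>u \<rightarrow> 0\<close>
  expresses \<open>\<alpha>\<close> through \<open>\<delta>\<close> and \<open>L = lim t \<beta> t\<close>. Then, with \<open>w = x u\<close> fixed and \<open>x \<rightarrow> \<infinity>\<close>, the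
  increments over a step \<open>w\<close> of \<open>x \<delta> x\<close> tend to \<open>w \<beta> w - L\<close>, which is hence additive in \<open>w\<close>, and so
  linear. This determines \<open>\<beta>\<close> and \<open>\<alpha>\<close>, i.e. \<open>g\<close> and \<open>f\<close> up to constants. Positivity of the parameters
  is forced by integrability, because \<open>1 / x\<close> is integrable neither at \<open>0\<close> nor at \<open>\<infinity>\<close>.\<close>

subsection \<open>The functional equation\<close>

text \<open>Additivity gives homogeneity under positive integers, hence under positive rationals,
  and continuity extends it to all positive reals. Every argument stays in the open half-line, so no
  value at 0 is involved.\<close>

lemma continuous_additive_on_pos:
  fixes E :: "real \<Rightarrow> real"
  assumes cont: "continuous_on {0<..} E"
    and add: "\<And>s t. 0 < s \<Longrightarrow> 0 < t \<Longrightarrow> E (s + t) = E s + E t"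
    and "0 < t"
  shows "E t = t * E 1"
proof -
  have mult: "E (real (Suc n) * s) = real (Suc n) * E s" if "0 < s" for n s
  proof (induction n)
    case (Suc n)
    have "E (real (Suc (Suc n)) * s) = E (real (Suc n) * s + s)"
      by (simp add: algebra_simps)
    also have "\<dots> = E (real (Suc n) * s) + E s"
      using that by (intro add) auto
    finally show ?case
      using Suc by (simp add: algebra_simps)
  qed simp
  have rat: "E (real (Suc m) / real (Suc n)) = real (Suc m) / real (Suc n) * E 1" for m n
  proof -
    have "real (Suc n) * E (real (Suc m) / real (Suc n)) = E (real (Suc m) * 1)"
      using mult[of "real (Suc m) / real (Suc n)" n] by simp
    also have "\<dots> = real (Suc m) * E 1"
      by (rule mult) simp
    finally show ?thesis
      by (simp add: field_simps del: of_nat_Suc)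
  qed
  \<comment> \<open>Rounding up by \<open>Suc\<close> keeps the numerator positive, as
    \<open>rat\<close> requires, while the error stays below
    \<open>1 / real (Suc n)\<close>.\<close>
  define r where "r n = real (Suc (nat \<lfloor>t * real (Suc n)\<rfloor>)) / real (Suc n)" for n
  have r_bounds: "t \<le> r n" "r n \<le> t + 1 / real (Suc n)" for n
  proof -
    have "0 \<le> t * real (Suc n)" using \<open>0 < t\<close> by simp
    then have "t * real (Suc n) \<le> real (Suc (nat \<lfloor>t * real (Suc n)\<rfloor>))"
      "real (Suc (nat \<lfloor>t * real (Suc n)\<rfloor>)) \<le> t * real (Suc n) + 1"
      by linarith+
    then show "t \<le> r n" "r n \<le> t + 1 / real (Suc n)"
      unfolding r_def by (simp_all add: field_simps del: of_nat_Suc)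
  qed
  have "r \<longlonglongrightarrow> t"
  proof (rule tendsto_sandwich[where f = "\<lambda>_. t" and h = "\<lambda>n. t + 1 / real (Suc n)"])
    show "(\<lambda>n. t + 1 / real (Suc n)) \<longlonglongrightarrow> t"
      using tendsto_add[OF tendsto_const[of t] LIMSEQ_inverse_real_of_nat]
      by (simp add: inverse_eq_divide)
  qed (use r_bounds in auto)
  moreover have "isCont E t"
    using cont \<open>0 < t\<close> by (simp add: continuous_on_eq_continuous_at)
  ultimately have "(\<lambda>n. E (r n)) \<longlonglongrightarrow> E t"
    by (rule isCont_tendsto_compose[rotated])
  moreover have "(\<lambda>n. E (r n)) = (\<lambda>n. r n * E 1)"
    unfolding r_def using rat by blast
  moreover have "(\<lambda>n. r n * E 1) \<longlonglongrightarrow> t * E 1"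
    using \<open>r \<longlonglongrightarrow> t\<close> by (intro tendsto_intros)
  ultimately show ?thesis
    using LIMSEQ_unique by metis
qed

text \<open>After integration, \<open>L\<close> becomes the exponent of \<open>y\<close> in
  \<open>g\<close>, \<open>K\<close> that of \<open>x\<close> in \<open>f\<close>, and
  \<open>c\<close> the exponential rate shared by both.\<close>

lemma derivative_functional_equation:
  fixes \<alpha> \<beta> \<delta> :: "real \<Rightarrow> real"
  assumes cont: "continuous_on {0<..} \<beta>" "continuous_on {0<..} \<delta>"
    and eq: "\<And>x u. 0 < x \<Longrightarrow> 0 < u \<Longrightarrow> \<alpha> x + u * \<beta> (u * (1 + x)) = (1 + u) * \<delta> (x * (1 + u))"
  obtains K L c where "\<And>y. 0 < y \<Longrightarrow> \<beta> y = L / y - c"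
    and "\<And>x. 0 < x \<Longrightarrow> \<alpha> x = K / x - L / (1 + x) - c"
proof -
  have isCont: "isCont \<beta> t" "isCont \<delta> t" if "0 < t" for t
    using cont that by (auto simp: continuous_on_eq_continuous_at)
  have lim0: "((\<lambda>u. u * \<beta> (u * (1 + x))) \<longlongrightarrow> \<delta> x - \<alpha> x) (at_right 0)" if x: "0 < x" for x
  proof -
    have "((\<lambda>u. x * (1 + u)) \<longlongrightarrow> x * (1 + 0)) (at_right 0)"
      by (intro tendsto_intros)
    then have "((\<lambda>u. \<delta> (x * (1 + u))) \<longlongrightarrow> \<delta> x) (at_right 0)"
      using isCont(2)[OF x] by (auto intro: isCont_tendsto_compose)
    then have "((\<lambda>u. (1 + u) * \<delta> (x * (1 + u)) - \<alpha> x) \<longlongrightarrow> (1 + 0) * \<delta> x - \<alpha> x) (at_right 0)"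
      by (intro tendsto_intros)
    moreover have "\<forall>\<^sub>F u in at_right 0. (1 + u) * \<delta> (x * (1 + u)) - \<alpha> x = u * \<beta> (u * (1 + x))"
      using eq[OF x] by (auto simp: eventually_at_filter intro!: always_eventually) (smt (verit))
    ultimately show ?thesis
      by (auto intro: Lim_transform_eventually)
  qed
  \<comment> \<open>At \<open>x = 1\<close>, \<open>lim0\<close> says that
    \<open>u * \<beta> (2 * u)\<close> tends to \<open>\<delta> 1 - \<alpha> 1\<close>; the factor 2
    makes \<open>L\<close> the limit of \<open>t * \<beta> t\<close> at 0.\<close>
  define L where "L = 2 * (\<delta> 1 - \<alpha> 1)"
  have \<alpha>: "\<alpha> x = \<delta> x - L / (1 + x)" if x: "0 < x" for x
  proof -
    \<comment> \<open>Rescaling \<open>u\<close> by \<open>(1 + x) / 2\<close> turns the argument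
      \<open>2 * u\<close> of \<beta> into \<open>u * (1 + x)\<close>, so the limits for
      \<open>1\<close> and for \<open>x\<close> can be compared.\<close>
    have "filterlim (\<lambda>u. u * ((1 + x) / 2)) (at_right 0) (at_right 0)"
      unfolding filterlim_at using x
      by (auto intro!: tendsto_eq_intros simp: eventually_at_filter)
    from filterlim_compose[OF lim0[of 1] this]
    have "((\<lambda>u. u * ((1 + x) / 2) * \<beta> (u * ((1 + x) / 2) * (1 + 1))) \<longlongrightarrow> L / 2) (at_right 0)"
      by (simp add: L_def diff_divide_distrib)
    moreover have "u * ((1 + x) / 2) * (1 + 1) = u * (1 + x)" for u
      by simp
    ultimately have "((\<lambda>u. (1 + x) / 2 * (u * \<beta> (u * (1 + x)))) \<longlongrightarrow> L / 2) (at_right 0)"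
      by (simp only: mult.assoc mult.left_commute)
    moreover have "((\<lambda>u. (1 + x) / 2 * (u * \<beta> (u * (1 + x)))) \<longlongrightarrow> (1 + x) / 2 * (\<delta> x - \<alpha> x)) (at_right 0)"
      by (intro tendsto_mult lim0 x tendsto_const)
    ultimately have "(1 + x) / 2 * (\<delta> x - \<alpha> x) = L / 2"
      using tendsto_unique trivial_limit_at_right_real by blast
    then show ?thesis
      using x by (simp add: field_simps)
  qed
  \<comment> \<open>Setting \<open>u = w / x\<close> and multiplying the equation by
    \<open>x\<close> turns its right side into \<open>(x + w) * \<delta> (x + w)\<close>, so the
    equation becomes one about increments of \<Delta>.\<close>
  define \<Delta> where "\<Delta> x = x * \<delta> x" for x
  define E where "E w = w * \<beta> w - L" for w
  have incr: "\<Delta> (x + w) - \<Delta> x = w * \<beta> (w / x + w) - L * (x / (1 + x))" if "0 < x" "0 < w" for x w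
  proof -
    have "x * (\<delta> x - L / (1 + x) + w / x * \<beta> (w / x * (1 + x))) = x * ((1 + w / x) * \<delta> (x * (1 + w / x)))"
      using eq[of x "w / x"] \<alpha>[of x] that by simp
    moreover have "w / x * (1 + x) = w / x + w" "x * (1 + w / x) = x + w"
      using that by (simp_all add: field_simps)
    moreover have "x * ((1 + w / x) * z) = (x + w) * z" for z
      using that by (simp add: field_simps)
    moreover have "x * (\<delta> x - L / (1 + x) + w / x * z) = \<Delta> x - L * (x / (1 + x)) + w * z" for z
      using that by (simp add: \<Delta>_def distrib_left right_diff_distrib mult.commute)
    ultimately have "\<Delta> x - L * (x / (1 + x)) + w * \<beta> (w / x + w) = (x + w) * \<delta> (x + w)"
      by metis
    then show ?thesis
      unfolding \<Delta>_def[of "x + w"] by (simp only: diff_eq_eq eq_diff_eq diff_add_eq add.commute)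
  qed
  have lim: "((\<lambda>x. \<Delta> (x + w) - \<Delta> x) \<longlongrightarrow> E w) at_top" if w: "0 < w" for w
  proof -
    have "((\<lambda>x. w / x + w) \<longlongrightarrow> 0 + w) at_top"
      by (intro tendsto_add tendsto_const tendsto_divide_0[OF tendsto_const] filterlim_ident
          filterlim_at_top_imp_at_infinity)
    then have "((\<lambda>x. \<beta> (w / x + w)) \<longlongrightarrow> \<beta> w) at_top"
      using isCont(1)[OF w] by (auto intro: isCont_tendsto_compose)
    moreover have "((\<lambda>x::real. x / (1 + x)) \<longlongrightarrow> 1) at_top"
      by real_asymp
    ultimately have "((\<lambda>x. w * \<beta> (w / x + w) - L * (x / (1 + x))) \<longlongrightarrow> w * \<beta> w - L * 1) at_top"
      by (intro tendsto_intros)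
    then have "((\<lambda>x. w * \<beta> (w / x + w) - L * (x / (1 + x))) \<longlongrightarrow> E w) at_top"
      by (simp add: E_def)
    moreover have "\<forall>\<^sub>F x in at_top. w * \<beta> (w / x + w) - L * (x / (1 + x)) = \<Delta> (x + w) - \<Delta> x"
      using eventually_gt_at_top[of 0] by eventually_elim (use incr w in simp)
    ultimately show ?thesis
      by (rule Lim_transform_eventually)
  qed
  \<comment> \<open>An increment over \<open>s + t\<close> is one over \<open>s\<close> from
    \<open>x\<close> followed by one over \<open>t\<close> from \<open>x + s\<close>. The shifted
    starting point does not change the limit.\<close>
  have "E (s + t) = E s + E t" if st: "0 < s" "0 < t" for s t
  proof -
    have "filterlim (\<lambda>x. x + s) at_top at_top"
      by real_asymp
    from filterlim_compose[OF lim[OF st(2)] this] lim[OF st(1)]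
    have "((\<lambda>x. (\<Delta> (x + s + t) - \<Delta> (x + s)) + (\<Delta> (x + s) - \<Delta> x)) \<longlongrightarrow> E t + E s) at_top"
      by (intro tendsto_add)
    then have "((\<lambda>x. \<Delta> (x + (s + t)) - \<Delta> x) \<longlongrightarrow> E t + E s) at_top"
      by (simp add: ac_simps)
    with lim[of "s + t"] st show ?thesis
      using tendsto_unique trivial_limit_at_top_linorder by (metis add.commute add_pos_pos)
  qed
  moreover have "continuous_on {0<..} E"
    unfolding E_def by (intro continuous_intros cont)
  ultimately have lin: "E t = t * E 1" if "0 < t" for t
    using continuous_additive_on_pos that by blast
  define c where "c = - E 1"
  have \<beta>: "\<beta> y = L / y - c" if "0 < y" for y
    using lin[OF that] that unfolding E_def[of y] c_def by (simp add: field_simps)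
  \<comment> \<open>With \<beta> known, \<open>incr\<close> can be evaluated exactly rather than in
    the limit: the terms in \<open>L\<close> cancel.\<close>
  have step: "\<Delta> (x + w) - \<Delta> x = - c * w" if "0 < x" "0 < w" for x w
  proof -
    have "w / x + w = w * (1 + x) / x" "0 < w / x + w"
      using that by (simp_all add: field_simps add_pos_pos)
    then have "\<beta> (w / x + w) = L / (w * (1 + x) / x) - c"
      using \<beta>[of "w / x + w"] by metis
    then have "w * \<beta> (w / x + w) = w * (L / (w * (1 + x) / x)) - c * w"
      by (simp only: right_diff_distrib mult.commute)
    also have "w * (L / (w * (1 + x) / x)) = L * (x / (1 + x))"
      using that by simp
    finally show ?thesis
      using incr[OF that] by simp
  qed
  define K where "K = \<Delta> 1 + c"
  \<comment> \<open>The point \<open>x + 1\<close> is reached from \<open>x\<close> by a step 1 and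
    from \<open>1\<close> by a step \<open>x\<close>; comparing the two avoids a case split on
    whether \<open>x\<close> exceeds 1.\<close>
  have \<Delta>: "\<Delta> x = K - c * x" if "0 < x" for x
    using step[of x 1] step[of 1 x] that unfolding K_def by (simp add: algebra_simps)
  have "\<delta> x = K / x - c" if "0 < x" for x
    using \<Delta>[OF that] that unfolding \<Delta>_def by (simp add: field_simps)
  then have "\<alpha> x = K / x - L / (1 + x) - c" if "0 < x" for x
    using \<alpha>[OF that] that by simp
  with \<beta> show thesis
    by (rule that)
qed

section \<open>Integrability forces positive parameters\<close>

lemma nn_integral_inverse_Icc:
  fixes s t :: real
  assumes "0 < s" "s \<le> t"
  shows "(\<integral>\<^sup>+x. ennreal (1 / x) * indicator {s..t} x \<partial>lborel) = ennreal (ln t - ln s)"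
  using assms by (intro nn_integral_FTC_Icc) (auto intro!: derivative_eq_intros simp: field_simps)

text \<open>The integral of \<open>m / x\<close> over \<open>{s..t}\<close> is \<open>m\<close>
  times the logarithmic length of the interval, which is unbounded at either end of the
  half-line.\<close>

lemma nn_integral_eq_top_if_ge_inverse:
  fixes k :: "real \<Rightarrow> real"
  assumes "0 < m" and S: "S = {0<..1} \<or> S = {1..}" and ge: "\<And>x. x \<in> S \<Longrightarrow> m / x \<le> k x"
  shows "(\<integral>\<^sup>+x. ennreal (k x) \<partial>lborel) = \<top>"
proof (rule ccontr)
  assume "(\<integral>\<^sup>+x. ennreal (k x) \<partial>lborel) \<noteq> \<top>"
  then obtain r where r: "(\<integral>\<^sup>+x. ennreal (k x) \<partial>lborel) = ennreal r" "0 \<le> r"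
    by (cases "\<integral>\<^sup>+x. ennreal (k x) \<partial>lborel") auto
  \<comment> \<open>Chosen so that \<open>{1..R}\<close> or \<open>{1 / R..1}\<close> has
    logarithmic length \<open>r / m + 1\<close> and contributes \<open>r + m\<close>, more than the
    supposed total \<open>r\<close>.\<close>
  define R where "R = exp (r / m + 1)"
  have "1 \<le> R" using r \<open>0 < m\<close> by (simp add: R_def)
  obtain s t where st: "0 < s" "s \<le> t" "{s..t} \<subseteq> S" "ln t - ln s = r / m + 1"
  proof (cases "S = {1..}")
    case True
    with that[of 1 R] \<open>1 \<le> R\<close> show thesis
      by (auto simp: R_def)
  next
    case False
    then have "S = {0<..1}"
      using S by blast
    moreover have R: "0 < 1 / R" "1 / R \<le> 1" "ln 1 - ln (1 / R) = r / m + 1"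
      using \<open>1 \<le> R\<close> by (simp_all add: R_def ln_div)
    ultimately show thesis
      using that[of "1 / R" 1] by (simp add: subset_iff less_le_trans[OF R(1)] del: zero_less_divide_1_iff)
  qed
  have "ennreal (r + m) = ennreal m * (\<integral>\<^sup>+x. ennreal (1 / x) * indicator {s..t} x \<partial>lborel)"
    using st \<open>0 < m\<close> r by (simp add: nn_integral_inverse_Icc ennreal_mult[symmetric] field_simps)
  also have "\<dots> = (\<integral>\<^sup>+x. ennreal m * (ennreal (1 / x) * indicator {s..t} x) \<partial>lborel)"
    by (rule nn_integral_cmult[symmetric]) measurable
  also have "\<dots> \<le> (\<integral>\<^sup>+x. ennreal (k x) \<partial>lborel)"
  proof (rule nn_integral_mono)
    fix x :: real
    show "ennreal m * (ennreal (1 / x) * indicator {s..t} x) \<le> ennreal (k x)"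
    proof (cases "x \<in> {s..t}")
      case True
      then have "ennreal m * ennreal (1 / x) = ennreal (m / x)"
        using st \<open>0 < m\<close> by (subst ennreal_mult[symmetric]) auto
      with True ge[of x] st show ?thesis
        by (auto intro!: ennreal_leI)
    qed simp
  qed
  finally show False
    using r \<open>0 < m\<close> by simp
qed

lemma inverse_le_powr:
  fixes x r :: real
  shows "0 < x \<Longrightarrow> x \<le> 1 \<Longrightarrow> r \<le> 0 \<Longrightarrow> 1 / x \<le> x powr (r - 1)"
    and "1 \<le> x \<Longrightarrow> 0 \<le> r \<Longrightarrow> 1 / x \<le> x powr (r - 1)"
  using powr_mono'[of "r - 1" "-1" x] powr_mono[of "-1" "r - 1" x]
  by (auto simp: powr_minus_divide)

text \<open>The behaviour at 0, where the exponential is bounded below, decides \<open>b\<close>.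
  The behaviour at infinity decides \<open>c\<close>: for \<open>b > 0\<close> and
  \<open>c \<le> 0\<close> the kernel dominates \<open>1 / y\<close> there.\<close>

lemma gamma_kernel_parameters_pos:
  assumes fin: "(\<integral>\<^sup>+y. ennreal (gamma_kernel b c y) \<partial>lborel) \<noteq> \<top>"
  shows "0 < b" "0 < c"
proof -
  show "0 < b"
  proof (rule ccontr)
    assume "\<not> 0 < b"
    have "exp (- \<bar>c\<bar>) / y \<le> gamma_kernel b c y" if y: "y \<in> {0<..1}" for y
    proof -
      have "c * y \<le> \<bar>c\<bar> * 1"
        using y by (intro mult_mono) auto
      then have "1 / y * exp (- \<bar>c\<bar>) \<le> y powr (b - 1) * exp (- c * y)"
        using y \<open>\<not> 0 < b\<close> by (intro mult_mono inverse_le_powr) auto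
      with y show ?thesis
        by (simp add: gamma_kernel_def)
    qed
    then show False
      using fin nn_integral_eq_top_if_ge_inverse[of "exp (- \<bar>c\<bar>)" "{0<..1}"] by auto
  qed
  show "0 < c"
  proof (rule ccontr)
    assume "\<not> 0 < c"
    have "1 / y \<le> gamma_kernel b c y" if y: "y \<in> {1..}" for y
    proof -
      have "1 / y * 1 \<le> y powr (b - 1) * exp (- c * y)"
        using y \<open>0 < b\<close> \<open>\<not> 0 < c\<close>
        by (intro mult_mono inverse_le_powr) (auto simp: mult_nonpos_nonneg)
      with y show ?thesis
        by (simp add: gamma_kernel_def)
    qed
    then show False
      using fin nn_integral_eq_top_if_ge_inverse[of 1 "{1..}"] by auto
  qed
qed

text \<open>On \<open>{0<..1}\<close> the denominator is at most \<open>2 powr b\<close> and the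
  exponential at least \<open>exp (- c)\<close>, so \<open>x powr (a - 1)\<close> alone decides
  integrability at 0.\<close>

lemma kummer_kernel_parameter_pos:
  assumes fin: "(\<integral>\<^sup>+x. ennreal (kummer_kernel a (b - a) c x) \<partial>lborel) \<noteq> \<top>" and "0 < b" "0 < c"
  shows "0 < a"
proof (rule ccontr)
  assume "\<not> 0 < a"
  have "exp (- c) / 2 powr b / x \<le> kummer_kernel a (b - a) c x" if x: "x \<in> {0<..1}" for x
  proof -
    have "1 / x * (1 / 2 powr b) * exp (- c) \<le> x powr (a - 1) * (1 / (1 + x) powr b) * exp (- c * x)"
      using x \<open>\<not> 0 < a\<close> \<open>0 < b\<close> \<open>0 < c\<close>
      by (intro mult_mono inverse_le_powr divide_left_mono powr_mono2) auto
    with x show ?thesis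
      by (simp add: kummer_kernel_def mult.commute)
  qed
  then show False
    using fin nn_integral_eq_top_if_ge_inverse[of "exp (- c) / 2 powr b" "{0<..1}"] by auto
qed

section \<open>From a factorising density to the kernels\<close>

lemma DERIV_eq_imp_differ_by_const:
  fixes \<phi> \<psi> D :: "real \<Rightarrow> real"
  assumes "\<And>x. 0 < x \<Longrightarrow> (\<phi> has_real_derivative D x) (at x)"
    and "\<And>x. 0 < x \<Longrightarrow> (\<psi> has_real_derivative D x) (at x)"
  obtains k where "\<And>x. 0 < x \<Longrightarrow> \<phi> x = \<psi> x + k"
proof -
  have "\<exists>k. \<forall>x\<in>{0<..}. \<phi> x - \<psi> x = k"
  proof (rule has_field_derivative_zero_constant)
    fix x :: real assume "x \<in> {0<..}"
    then have "((\<lambda>x. \<phi> x - \<psi> x) has_real_derivative D x - D x) (at x)"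
      by (intro DERIV_diff assms) auto
    then show "((\<lambda>x. \<phi> x - \<psi> x) has_real_derivative 0) (at x within {0<..})"
      by (simp add: has_field_derivative_at_within)
  qed simp
  then show thesis
    using that by (auto simp: algebra_simps)
qed

text \<open>Here \<open>h\<close> is the joint density of \<open>(U, V)\<close> on the quadrant. Its
  factorisation is expressed by vanishing 2 by 2 minors, which mention no marginal densities. The
  signs of \<open>a\<close>, \<open>b\<close>, \<open>c\<close> are left open because they depend on
  integrability.\<close>

lemma rank_one_imp_kummer_gamma:
  fixes f g :: "real \<Rightarrow> real" and h :: "real \<Rightarrow> real \<Rightarrow> real"
  assumes f: "\<And>x. 0 < x \<Longrightarrow> 0 < f x" "f C1_differentiable_on {0<..}"
    and g: "\<And>y. 0 < y \<Longrightarrow> 0 < g y" "g C1_differentiable_on {0<..}"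
    and h: "\<And>u v. h u v = f (v / (1 + u)) * g (u * (1 + v / (1 + u))) * ((1 + v / (1 + u)) / (1 + u))"
    and rank1: "\<And>u u' v v'. 0 < u \<Longrightarrow> 0 < u' \<Longrightarrow> 0 < v \<Longrightarrow> 0 < v' \<Longrightarrow> h u v * h u' v' = h u v' * h u' v"
  shows "\<exists>a b c C1 C2. 0 < C1 \<and> 0 < C2 \<and> (\<forall>x>0. f x = C1 * kummer_kernel a (b - a) c x) \<and>
    (\<forall>y>0. g y = C2 * gamma_kernel b c y)"
proof -
  obtain f' where f': "\<And>x. 0 < x \<Longrightarrow> (f has_real_derivative f' x) (at x)" "continuous_on {0<..} f'"
    using f(2) by (auto simp: C1_differentiable_on_def has_real_derivative_iff_has_vector_derivative)
  obtain g' where g': "\<And>y. 0 < y \<Longrightarrow> (g has_real_derivative g' y) (at y)" "continuous_on {0<..} g'"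
    using g(2) by (auto simp: C1_differentiable_on_def has_real_derivative_iff_has_vector_derivative)
  have cont: "continuous_on {0<..} f" "continuous_on {0<..} g"
    using f' g' by (auto intro!: continuous_at_imp_continuous_on DERIV_isCont)
  \<comment> \<open>The numerator \<open>1 + x\<close> of the Jacobian is absorbed into
    \<open>A\<close>; its denominator contributes only \<open>- ln (1 + u)\<close>, which is
    constant at fixed \<open>u\<close>.\<close>
  define A where "A x = ln (f x) + ln (1 + x)" for x
  define B where "B y = ln (g y)" for y
  define \<alpha> where "\<alpha> x = f' x / f x + 1 / (1 + x)" for x
  define \<beta> where "\<beta> y = g' y / g y" for y
  \<comment> \<open>The reference value \<open>u = 1\<close> corresponds to \<open>x = v / 2\<close>
    and \<open>y = 1 + v / 2\<close>, so \<delta> is the derivative of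
    \<open>A (v / 2) + B (1 + v / 2)\<close>, the logarithm of the \<open>v\<close>-factor up to a
    constant.\<close>
  define \<delta> where "\<delta> v = (\<alpha> (v / 2) + \<beta> (1 + v / 2)) / 2" for v
  have A: "(A has_real_derivative \<alpha> x) (at x)" if "0 < x" for x
    unfolding A_def \<alpha>_def using that f(1)[OF that]
    by (auto intro!: derivative_eq_intros f'(1))
  have B: "(B has_real_derivative \<beta> y) (at y)" if "0 < y" for y
    unfolding B_def \<beta>_def using that g(1)[OF that]
    by (auto intro!: derivative_eq_intros g'(1))
  have cont_\<alpha>: "continuous_on {0<..} \<alpha>"
    unfolding \<alpha>_def using f(1) by (intro continuous_intros f' cont) (auto simp: less_imp_neq[symmetric] add_pos_pos)
  have cont_\<beta>: "continuous_on {0<..} \<beta>"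
    unfolding \<beta>_def using g(1) by (intro continuous_intros g' cont) (auto simp: less_imp_neq[symmetric])
  have cont_\<delta>: "continuous_on {0<..} \<delta>"
    unfolding \<delta>_def
    by (intro continuous_intros continuous_on_compose2[OF cont_\<alpha>] continuous_on_compose2[OF cont_\<beta>]) auto
  have hpos: "0 < h u v" if "0 < u" "0 < v" for u v
    unfolding h using that by (intro mult_pos_pos divide_pos_pos f g add_pos_pos) auto
  have ln_h: "ln (h u (x * (1 + u))) = A x + B (u * (1 + x)) - ln (1 + u)" if "0 < u" "0 < x" for u x
  proof -
    have "h u (x * (1 + u)) = f x * g (u * (1 + x)) * ((1 + x) / (1 + u))"
      using that by (simp add: h)
    moreover have "0 < f x" "0 < g (u * (1 + x))"
      using that f g by auto
    ultimately show ?thesis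
      using that by (simp add: A_def B_def ln_mult ln_div)
  qed
  have "\<alpha> x + u * \<beta> (u * (1 + x)) = (1 + u) * \<delta> (x * (1 + u))" if "0 < x" "0 < u" for x u
  proof -
    \<comment> \<open>Collects what does not depend on \<open>x\<close> when the minor identity with
      reference point \<open>(1, 1)\<close> is written in logarithms. Differentiating in
      \<open>x\<close> removes it.\<close>
    define k where "k = ln (h u 1) - ln (h 1 1) + ln (1 + u) - ln 2"
    have eq: "A x + B (u * (1 + x)) = A (x * (1 + u) / 2) + B (1 + x * (1 + u) / 2) + k" if "0 < x" for x
    proof -
      have v: "0 < x * (1 + u)" using that \<open>0 < u\<close> by simp
      have "ln (h u (x * (1 + u)) * h 1 1) = ln (h u 1 * h 1 (x * (1 + u)))"
        using rank1[of u 1 "x * (1 + u)" 1] v \<open>0 < u\<close> by simp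
      then have "ln (h u (x * (1 + u))) + ln (h 1 1) = ln (h u 1) + ln (h 1 (x * (1 + u)))"
        using hpos[OF \<open>0 < u\<close> v] hpos[of 1 1] hpos[of u 1] hpos[of 1 "x * (1 + u)"] v \<open>0 < u\<close>
        by (simp add: ln_mult_pos)
      moreover have "ln (h 1 (x * (1 + u))) = A (x * (1 + u) / 2) + B (1 + x * (1 + u) / 2) - ln 2"
        using ln_h[of 1 "x * (1 + u) / 2"] v by simp
      ultimately show ?thesis
        using ln_h[of u x] that \<open>0 < u\<close> by (simp add: k_def)
    qed
    have "((\<lambda>x. A x + B (u * (1 + x))) has_real_derivative \<alpha> x + \<beta> (u * (1 + x)) * u) (at x)"
      using that by (auto intro!: derivative_eq_intros A DERIV_chain2[OF B])
    moreover have "((\<lambda>x. A (x * (1 + u) / 2) + B (1 + x * (1 + u) / 2) + k) has_real_derivative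
        \<alpha> (x * (1 + u) / 2) * ((1 + u) / 2) + \<beta> (1 + x * (1 + u) / 2) * ((1 + u) / 2)) (at x)"
      using that by (auto intro!: derivative_eq_intros DERIV_chain2[OF A] DERIV_chain2[OF B] add_pos_pos
          simp: algebra_simps add_divide_distrib)
    then have "((\<lambda>x. A x + B (u * (1 + x))) has_real_derivative
        \<alpha> (x * (1 + u) / 2) * ((1 + u) / 2) + \<beta> (1 + x * (1 + u) / 2) * ((1 + u) / 2)) (at x)"
      by (rule has_field_derivative_transform_within_open[where S = "{0<..}"]) (use eq that in auto)
    ultimately have "\<alpha> x + \<beta> (u * (1 + x)) * u =
        \<alpha> (x * (1 + u) / 2) * ((1 + u) / 2) + \<beta> (1 + x * (1 + u) / 2) * ((1 + u) / 2)"
      by (rule DERIV_unique)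
    moreover have factor: "p * ((1 + u) / 2) + q * ((1 + u) / 2) = (1 + u) * ((p + q) / 2)" for p q
      by (simp add: algebra_simps add_divide_distrib)
    ultimately show ?thesis
      unfolding \<delta>_def factor[symmetric] by (simp only: mult.commute)
  qed
  then obtain K L c where
    \<beta>: "\<And>y. 0 < y \<Longrightarrow> \<beta> y = L / y - c" and \<alpha>: "\<And>x. 0 < x \<Longrightarrow> \<alpha> x = K / x - L / (1 + x) - c"
    using derivative_functional_equation[OF cont_\<beta> cont_\<delta>] by metis
  obtain kA where kA: "\<And>x. 0 < x \<Longrightarrow> A x = K * ln x - L * ln (1 + x) - c * x + kA"
  proof (rule DERIV_eq_imp_differ_by_const[OF A])
    show "((\<lambda>x. K * ln x - L * ln (1 + x) - c * x) has_real_derivative \<alpha> x) (at x)" if "0 < x" for x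
      using that by (auto intro!: derivative_eq_intros simp: \<alpha>)
  qed auto
  obtain kB where kB: "\<And>y. 0 < y \<Longrightarrow> B y = L * ln y - c * y + kB"
  proof (rule DERIV_eq_imp_differ_by_const[OF B])
    show "((\<lambda>y. L * ln y - c * y) has_real_derivative \<beta> y) (at y)" if "0 < y" for y
      using that by (auto intro!: derivative_eq_intros simp: \<beta>)
  qed auto
  \<comment> \<open>Undoing the factor \<open>1 + x\<close> inside \<open>A\<close> raises the
    denominator exponent from \<open>L\<close> to \<open>L + 1\<close>. This equals
    \<open>b\<close>, which is why the second Kummer parameter is \<open>b - a\<close>.\<close>
  have "f x = exp kA * kummer_kernel (K + 1) (L + 1 - (K + 1)) c x" if x: "0 < x" for x
  proof -
    have "f x = exp (A x - ln (1 + x))"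
      using f(1)[OF x] x by (simp add: A_def)
    also have "A x - ln (1 + x) = kA + (K * ln x - (L + 1) * ln (1 + x) + - c * x)"
      using kA[OF x] by (simp add: algebra_simps)
    also have "exp \<dots> = exp kA * (exp (K * ln x) / exp ((L + 1) * ln (1 + x)) * exp (- c * x))"
      by (simp only: exp_add exp_diff)
    finally show ?thesis
      using x by (simp add: kummer_kernel_def powr_def)
  qed
  moreover have "g y = exp kB * gamma_kernel (L + 1) c y" if y: "0 < y" for y
  proof -
    have "g y = exp (B y)"
      using g(1)[OF y] by (simp add: B_def)
    also have "B y = kB + (L * ln y + - c * y)"
      using kB[OF y] by simp
    also have "exp \<dots> = exp kB * (exp (L * ln y) * exp (- c * y))"
      by (simp only: exp_add)
    finally show ?thesis
      using y by (simp add: gamma_kernel_def powr_def)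
  qed
  ultimately show ?thesis
    by (intro exI[of _ "K + 1"] exI[of _ "L + 1"] exI[of _ c] exI[of _ "exp kA"] exI[of _ "exp kB"]) simp
qed

subsection \<open>Change of variables and independence\<close>

text \<open>By continuity the set of disagreement is open, and an open null set is empty.\<close>

lemma AE_lborel_pos_continuous_eq:
  fixes \<phi> \<psi> :: "real \<Rightarrow> real"
  assumes cont: "continuous_on {0<..} \<phi>" "continuous_on {0<..} \<psi>"
    and AE: "AE x in lborel. 0 < x \<longrightarrow> \<phi> x = \<psi> x"
    and "0 < x"
  shows "\<phi> x = \<psi> x"
proof -
  define S where "S = {0<..} \<inter> (\<lambda>x. \<phi> x - \<psi> x) -` (- {0})"
  have "open S"
    unfolding S_def by (intro continuous_open_preimage continuous_intros cont)
  moreover have "S = {x \<in> space lborel. \<not> (0 < x \<longrightarrow> \<phi> x = \<psi> x)}"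
    by (auto simp: S_def)
  ultimately have "S \<in> null_sets lborel"
    using AE AE_iff_null_sets[of S lborel] by (auto simp: AE_iff_null)
  then have "negligible S"
    by (simp add: negligible_iff_null_sets null_sets_completionI)
  then have "S = {}"
    using \<open>open S\<close> open_not_negligible by blast
  then show ?thesis
    using \<open>0 < x\<close> by (auto simp: S_def)
qed

text \<open>The factors \<open>p\<close> and \<open>q\<close> are controlled only almost everywhere,
  but the minor identity mentions only the continuous \<open>h\<close>. It therefore passes from
  almost all to all positive arguments, one variable at a time: first \<open>v'\<close> and
  \<open>v\<close> for good \<open>u\<close> and \<open>u'\<close>, then \<open>u'\<close> and
  \<open>u\<close>.\<close>

lemma AE_product_imp_rank_one:
  fixes h :: "real \<Rightarrow> real \<Rightarrow> real" and p q :: "real \<Rightarrow> ennreal"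
  assumes pos: "\<And>u v. 0 < u \<Longrightarrow> 0 < v \<Longrightarrow> 0 < h u v"
    and cont: "\<And>u. 0 < u \<Longrightarrow> continuous_on {0<..} (\<lambda>v. h u v)"
      "\<And>v. 0 < v \<Longrightarrow> continuous_on {0<..} (\<lambda>u. h u v)"
    and AE: "AE z in lborel \<Otimes>\<^sub>M lborel. 0 < fst z \<longrightarrow> 0 < snd z \<longrightarrow>
      ennreal (h (fst z) (snd z)) = p (fst z) * q (snd z)"
    and arg: "0 < u" "0 < u'" "0 < v" "0 < v'"
  shows "h u v * h u' v' = h u v' * h u' v"
proof -
  define good where "good u \<longleftrightarrow> (AE v in lborel. 0 < v \<longrightarrow> ennreal (h u v) = p u * q v)" for u
  have rank1: "h u v * h u' v' = h u v' * h u' v"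
    if "0 < u" "0 < u'" "good u" "good u'" "0 < v" "0 < v'" for u u' v v'
  proof -
    have both: "AE v in lborel. 0 < v \<longrightarrow> ennreal (h u v) = p u * q v \<and> ennreal (h u' v) = p u' * q v"
      using that(3,4) unfolding good_def by eventually_elim auto
    have eq: "h u v * h u' v' = h u v' * h u' v"
      if v: "0 < v" "ennreal (h u v) = p u * q v" "ennreal (h u' v) = p u' * q v"
        and v': "0 < v'" "ennreal (h u v') = p u * q v'" "ennreal (h u' v') = p u' * q v'" for v v'
    proof -
      \<comment> \<open>Both sides equal \<open>p u * p u' * q v * q v'\<close>. No division occurs,
        so zero or infinite values of \<open>p\<close> and \<open>q\<close> do no harm.\<close>
      have "ennreal (h u v * h u' v') = ennreal (h u v' * h u' v)"
        using v v' pos \<open>0 < u\<close> \<open>0 < u'\<close> by (simp add: ennreal_mult less_imp_le ac_simps)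
      then show ?thesis
        using pos v v' \<open>0 < u\<close> \<open>0 < u'\<close> by (simp add: less_imp_le)
    qed
    have "AE v in lborel. 0 < v \<longrightarrow> h u v * h u' v' = h u v' * h u' v"
      using both
    proof eventually_elim
      case (elim v)
      show ?case
      proof
        assume "0 < v"
        have "AE v' in lborel. 0 < v' \<longrightarrow> h u v * h u' v' = h u v' * h u' v"
          using both by eventually_elim (use eq elim \<open>0 < v\<close> in blast)
        then show "h u v * h u' v' = h u v' * h u' v"
          by (rule AE_lborel_pos_continuous_eq[rotated 2])
            (use that in \<open>auto intro!: continuous_intros cont\<close>)
      qed
    qed
    then show ?thesis
      by (rule AE_lborel_pos_continuous_eq[rotated 2])
        (use that in \<open>auto intro!: continuous_intros cont\<close>)
  qed
  have AE_good: "AE u in lborel. 0 < u \<longrightarrow> good u"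
    using lborel_pair.AE_pair[OF AE] unfolding good_def by eventually_elim auto
  then have "AE u in lborel. 0 < u \<longrightarrow> h u v * h u' v' = h u v' * h u' v"
  proof eventually_elim
    case (elim u)
    show ?case
    proof
      assume "0 < u"
      have "AE u' in lborel. 0 < u' \<longrightarrow> h u v * h u' v' = h u v' * h u' v"
        using AE_good by eventually_elim (use rank1 elim \<open>0 < u\<close> arg in blast)
      then show "h u v * h u' v' = h u v' * h u' v"
        by (rule AE_lborel_pos_continuous_eq[rotated 2])
          (use arg in \<open>auto intro!: continuous_intros cont\<close>)
    qed
  qed
  then show ?thesis
    by (rule AE_lborel_pos_continuous_eq[rotated 2])
      (use arg in \<open>auto intro!: continuous_intros cont\<close>)
qed

text \<open>Two linear substitutions, \<open>y = u (1 + x)\<close> at fixed \<open>x\<close> and then \<open>x = v / (1 + u)\<close> at fixed \<open>u\<close>,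
  avoid the multidimensional change of variables.\<close>

lemma nn_integral_change_of_variables:
  fixes F G :: "real \<Rightarrow> ennreal" and H :: "real \<times> real \<Rightarrow> ennreal"
  assumes [measurable]: "F \<in> borel_measurable borel" "G \<in> borel_measurable borel"
      "H \<in> borel_measurable (borel \<Otimes>\<^sub>M borel)"
    and F0: "\<And>x. x \<le> 0 \<Longrightarrow> F x = 0" and G0: "\<And>y. y \<le> 0 \<Longrightarrow> G y = 0"
  shows "(\<integral>\<^sup>+x. \<integral>\<^sup>+y. F x * G y * H (y / (1 + x), x * (1 + y / (1 + x))) \<partial>lborel \<partial>lborel) =
    (\<integral>\<^sup>+u. \<integral>\<^sup>+v. (if 0 < u \<and> 0 < v then F (v / (1 + u)) * G (u * (1 + v / (1 + u))) *
      ennreal ((1 + v / (1 + u)) / (1 + u)) else 0) * H (u, v) \<partial>lborel \<partial>lborel)"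
proof -
  \<comment> \<open>The integrand after the first substitution, whose Jacobian is
    \<open>1 + x\<close>. The second one contributes \<open>1 / (1 + u)\<close>.\<close>
  define K where "K x u = ennreal (1 + x) * (F x * G (u * (1 + x)) * H (u, x * (1 + u)))" for x u
  have [measurable]: "case_prod K \<in> borel_measurable (borel \<Otimes>\<^sub>M borel)"
    unfolding K_def by measurable
  have "(\<integral>\<^sup>+y. F x * G y * H (y / (1 + x), x * (1 + y / (1 + x))) \<partial>lborel) = (\<integral>\<^sup>+u. K x u \<partial>lborel)" for x
  proof (cases "0 < x")
    case True
    then show ?thesis
      unfolding K_def
      by (subst nn_integral_real_affine[where t = 0 and c = "1 + x"])
        (auto simp: nn_integral_cmult mult.commute intro!: arg_cong[where f = "nn_integral lborel"])
  qed (simp add: F0 K_def)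
  then have "(\<integral>\<^sup>+x. \<integral>\<^sup>+y. F x * G y * H (y / (1 + x), x * (1 + y / (1 + x))) \<partial>lborel \<partial>lborel) =
      (\<integral>\<^sup>+x. \<integral>\<^sup>+u. K x u \<partial>lborel \<partial>lborel)"
    by simp
  also have "\<dots> = (\<integral>\<^sup>+u. \<integral>\<^sup>+x. K x u \<partial>lborel \<partial>lborel)"
    by (rule lborel_pair.Fubini'[symmetric]) simp
  also have "\<dots> = (\<integral>\<^sup>+u. \<integral>\<^sup>+v. (if 0 < u \<and> 0 < v then F (v / (1 + u)) * G (u * (1 + v / (1 + u))) *
      ennreal ((1 + v / (1 + u)) / (1 + u)) else 0) * H (u, v) \<partial>lborel \<partial>lborel)"
  proof (rule nn_integral_cong)
    fix u :: real
    show "(\<integral>\<^sup>+x. K x u \<partial>lborel) = (\<integral>\<^sup>+v. (if 0 < u \<and> 0 < v then F (v / (1 + u)) *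
      G (u * (1 + v / (1 + u))) * ennreal ((1 + v / (1 + u)) / (1 + u)) else 0) * H (u, v) \<partial>lborel)"
    proof (cases "0 < u")
      case True
      have "(\<integral>\<^sup>+x. K x u \<partial>lborel) = ennreal \<bar>1 / (1 + u)\<bar> * (\<integral>\<^sup>+v. K (0 + 1 / (1 + u) * v) u \<partial>lborel)"
        using True by (intro nn_integral_real_affine) auto
      also have "\<dots> = (\<integral>\<^sup>+v. ennreal (1 / (1 + u)) * K (v / (1 + u)) u \<partial>lborel)"
        using True by (subst nn_integral_cmult[symmetric]) auto
      also have "\<dots> = (\<integral>\<^sup>+v. (if 0 < u \<and> 0 < v then F (v / (1 + u)) *
        G (u * (1 + v / (1 + u))) * ennreal ((1 + v / (1 + u)) / (1 + u)) else 0) * H (u, v) \<partial>lborel)"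
      proof (rule nn_integral_cong)
        fix v :: real
        show "ennreal (1 / (1 + u)) * K (v / (1 + u)) u = (if 0 < u \<and> 0 < v then F (v / (1 + u)) *
          G (u * (1 + v / (1 + u))) * ennreal ((1 + v / (1 + u)) / (1 + u)) else 0) * H (u, v)"
        proof (cases "0 < v")
          case v: True
          have "ennreal ((1 + v / (1 + u)) / (1 + u)) = ennreal (1 / (1 + u)) * ennreal (1 + v / (1 + u))"
            using True v by (subst ennreal_mult[symmetric]) auto
          moreover have "v / (1 + u) * (1 + u) = v"
            using True by simp
          ultimately show ?thesis
            using True v unfolding K_def by (simp only: if_True simp_thms ac_simps)
        next
          case False
          then have "F (v / (1 + u)) = 0"
            using True by (intro F0) (simp add: divide_le_0_iff)
          with False show ?thesis
            by (simp add: K_def)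
        qed
      qed
      finally show ?thesis .
    next
      case False
      have "K x u = 0" for x
      proof (cases "0 < x")
        case True
        then have "G (u * (1 + x)) = 0"
          using False by (intro G0) (simp add: mult_le_0_iff)
        then show ?thesis
          by (simp add: K_def)
      qed (simp add: K_def F0)
      then show ?thesis
        using False by simp
    qed
  qed
  finally show ?thesis .
qed

text \<open>This is \<open>nn_integral_change_of_variables\<close> with \<open>H\<close> the
  indicator of a measurable set, read as an equality of measures.\<close>

lemma (in prob_space) distributed_change_of_variables:
  fixes F G :: "real \<Rightarrow> ennreal"
  assumes D: "distributed M (lborel \<Otimes>\<^sub>M lborel) (\<lambda>\<omega>. (X \<omega>, Y \<omega>)) (\<lambda>(x, y). F x * G y)"
    and [measurable]: "F \<in> borel_measurable borel" "G \<in> borel_measurable borel"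
    and F0: "\<And>x. x \<le> 0 \<Longrightarrow> F x = 0" and G0: "\<And>y. y \<le> 0 \<Longrightarrow> G y = 0"
  shows "distributed M (lborel \<Otimes>\<^sub>M lborel)
    (\<lambda>\<omega>. (Y \<omega> / (1 + X \<omega>), X \<omega> * (1 + Y \<omega> / (1 + X \<omega>))))
    (\<lambda>(u, v). if 0 < u \<and> 0 < v then F (v / (1 + u)) * G (u * (1 + v / (1 + u))) *
      ennreal ((1 + v / (1 + u)) / (1 + u)) else 0)"
    (is "distributed M _ ?UV ?h")
proof -
  define T where "T = (\<lambda>(x::real, y::real). (y / (1 + x), x * (1 + y / (1 + x))))"
  have [measurable]: "T \<in> borel \<Otimes>\<^sub>M borel \<rightarrow>\<^sub>M borel \<Otimes>\<^sub>M borel"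
    unfolding T_def by measurable
  have [measurable]: "?h \<in> borel_measurable (borel \<Otimes>\<^sub>M borel)"
    by measurable
  have sets_eq: "sets (lborel \<Otimes>\<^sub>M lborel) = sets (borel \<Otimes>\<^sub>M borel :: (real \<times> real) measure)"
    by (intro sets_pair_measure_cong) auto
  have XY[measurable]: "(\<lambda>\<omega>. (X \<omega>, Y \<omega>)) \<in> measurable M (borel \<Otimes>\<^sub>M borel)"
    using distributed_measurable[OF D] measurable_cong_sets[OF refl sets_eq] by blast
  have UV: "?UV = T \<circ> (\<lambda>\<omega>. (X \<omega>, Y \<omega>))"
    by (auto simp: T_def)
  have meas: "?UV \<in> measurable M (borel \<Otimes>\<^sub>M borel)"
    unfolding UV by (rule measurable_comp[OF XY]) measurable
  have "distr M (lborel \<Otimes>\<^sub>M lborel) ?UV = density (lborel \<Otimes>\<^sub>M lborel) ?h"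
  proof (rule measure_eqI)
    fix A assume "A \<in> sets (distr M (lborel \<Otimes>\<^sub>M lborel) ?UV)"
    then have A[measurable]: "A \<in> sets (borel \<Otimes>\<^sub>M borel)"
      by (simp add: sets_eq)
    have "emeasure (distr M (lborel \<Otimes>\<^sub>M lborel) ?UV) A = (\<integral>\<^sup>+\<omega>. indicator A (T (X \<omega>, Y \<omega>)) \<partial>M)"
      using meas by (subst nn_integral_indicator[symmetric])
        (auto simp: nn_integral_distr sets_eq UV measurable_cong_sets[OF refl sets_eq] comp_def
          simp del: nn_integral_indicator)
    also have "\<dots> = (\<integral>\<^sup>+z. (case z of (x, y) \<Rightarrow> F x * G y) * indicator A (T z) \<partial>(lborel \<Otimes>\<^sub>M lborel))"
      by (rule distributed_nn_integral[OF D, symmetric]) simp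
    also have "\<dots> = (\<integral>\<^sup>+x. \<integral>\<^sup>+y. F x * G y * indicator A (y / (1 + x), x * (1 + y / (1 + x))) \<partial>lborel \<partial>lborel)"
      by (subst lborel.nn_integral_fst[symmetric]) (auto simp: T_def)
    also have "\<dots> = (\<integral>\<^sup>+u. \<integral>\<^sup>+v. ?h (u, v) * indicator A (u, v) \<partial>lborel \<partial>lborel)"
      using F0 G0 by (subst nn_integral_change_of_variables) auto
    also have "\<dots> = (\<integral>\<^sup>+z. ?h z * indicator A z \<partial>(lborel \<Otimes>\<^sub>M lborel))"
      by (subst lborel.nn_integral_fst[symmetric]) auto
    also have "\<dots> = emeasure (density (lborel \<Otimes>\<^sub>M lborel) ?h) A"
      by (subst emeasure_density) auto
    finally show "emeasure (distr M (lborel \<Otimes>\<^sub>M lborel) ?UV) A = emeasure (density (lborel \<Otimes>\<^sub>M lborel) ?h) A" .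
  qed simp
  with meas show ?thesis
    unfolding distributed_def by auto
qed

subsection \<open>Kummer and Gamma laws\<close>

context prob_space
begin

lemma indep_var_lborel:
  "indep_var lborel X lborel Y \<longleftrightarrow> indep_var borel X borel Y" for X Y :: "'a \<Rightarrow> real"
  unfolding indep_var_eq by simp

lemma nn_integral_scaled_density:
  assumes D: "distributed M lborel X (\<lambda>x. C * ennreal (k x))" and [measurable]: "k \<in> borel_measurable borel"
  shows "C * (\<integral>\<^sup>+x. ennreal (k x) \<partial>lborel) = 1"
proof -
  have "prob_space (distr M lborel X)"
    using distributed_measurable[OF D] by (intro prob_space_distr) auto
  then have "emeasure (density lborel (\<lambda>x. C * ennreal (k x))) UNIV = 1"
    using prob_space.emeasure_space_1 unfolding distributed_distr_eq_density[OF D] by fastforce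
  then show ?thesis
    by (simp add: emeasure_density nn_integral_cmult)
qed

text \<open>Total mass one forces \<open>C\<close> to be the reciprocal of the kernel's integral, so
  a law can be identified without computing any normalising constant.\<close>

lemma has_law_normalised_measureI:
  assumes D: "distributed M lborel X (\<lambda>x. C * ennreal (k x))"
    and [measurable]: "k \<in> borel_measurable borel" and nonneg: "\<And>x. 0 \<le> k x"
  shows "has_law M X (normalised_measure k)"
proof -
  have X: "X \<in> borel_measurable M" and distr: "distr M lborel X = density lborel (\<lambda>x. C * ennreal (k x))"
    using distributed_measurable[OF D] distributed_distr_eq_density[OF D] by auto
  have one: "C * (\<integral>\<^sup>+x. ennreal (k x) \<partial>lborel) = 1"
    using D by (rule nn_integral_scaled_density) measurable
  then have nz: "C \<noteq> 0" "(\<integral>\<^sup>+x. ennreal (k x) \<partial>lborel) \<noteq> 0"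
    by auto
  \<comment> \<open>An infinite factor times a nonzero one is infinite, which a product equal to 1
    excludes.\<close>
  have "C \<noteq> \<top>" "(\<integral>\<^sup>+x. ennreal (k x) \<partial>lborel) \<noteq> \<top>"
    using one nz by (auto simp: ennreal_mult_top ennreal_top_mult)
  then obtain r where r: "(\<integral>\<^sup>+x. ennreal (k x) \<partial>lborel) = ennreal r" "0 < r"
    using nz(2) by (cases "\<integral>\<^sup>+x. ennreal (k x) \<partial>lborel") (auto simp: less_le)
  have int: "(\<integral>x. k x \<partial>lborel) = r"
    using r nonneg by (subst integral_eq_nn_integral) auto
  from \<open>C \<noteq> \<top>\<close> obtain d where d: "C = ennreal d" "0 \<le> d"
    by (cases C) auto
  have "ennreal (d * r) = ennreal 1"
    using one d r by (simp add: ennreal_mult)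
  then have "d * r = 1"
    using d r by (subst (asm) ennreal_inj) auto
  then have "d = 1 / r"
    using r by (simp add: field_simps)
  then have "C * ennreal (k x) = ennreal (k x / (\<integral>y. k y \<partial>lborel))" for x
    unfolding int d(1) using nonneg r by (subst ennreal_mult[symmetric]) auto
  then show ?thesis
    unfolding has_law_def normalised_measure_def using X distr by simp
qed

text \<open>Pulling out the constant is valid even if the Bochner integral takes its default value 0
  for a non-integrable kernel: division by 0 then makes both densities 0.\<close>

lemma has_law_normalised_measureD:
  assumes law: "has_law M X (normalised_measure k)"
    and [measurable]: "k \<in> borel_measurable borel" and nonneg: "\<And>x. 0 \<le> k x"
  shows "distributed M lborel X (\<lambda>x. ennreal (1 / (\<integral>y. k y \<partial>lborel)) * ennreal (k x))"
proof -
  have "(\<lambda>x. ennreal (k x / (\<integral>y. k y \<partial>lborel))) =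
      (\<lambda>x. ennreal (1 / (\<integral>y. k y \<partial>lborel)) * ennreal (k x))"
    using nonneg by (subst ennreal_mult[symmetric]) (auto intro!: Bochner_Integration.integral_nonneg)
  then show ?thesis
    using law unfolding has_law_def normalised_measure_def distributed_def by auto
qed

end

section \<open>Transforming a Kummer-Gamma pair\<close>

lemma kummer_kernel_measurable [measurable]: "kummer_kernel \<alpha> \<beta> \<gamma> \<in> borel_measurable borel"
  unfolding kummer_kernel_def by measurable

lemma gamma_kernel_measurable [measurable]: "gamma_kernel \<alpha> \<gamma> \<in> borel_measurable borel"
  unfolding gamma_kernel_def by measurable

lemma kummer_kernel_nonneg: "0 \<le> kummer_kernel \<alpha> \<beta> \<gamma> x"
  by (simp add: kummer_kernel_def)

lemma gamma_kernel_nonneg: "0 \<le> gamma_kernel \<alpha> \<gamma> x"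
  by (simp add: gamma_kernel_def)

text \<open>With \<open>x = v / (1 + u)\<close> and \<open>y = u * (1 + x)\<close> one has
  \<open>x + y = u + v\<close>, so the exponentials agree. The powers of \<open>1 + x\<close>
  cancel, and \<open>v = x * (1 + u)\<close> absorbs \<open>1 + u\<close> up to the power
  \<open>a\<close>.\<close>

lemma kummer_gamma_kernel_identity:
  assumes "0 < u" "0 < v"
  shows "kummer_kernel a (b - a) c (v / (1 + u)) * gamma_kernel b c (u * (1 + v / (1 + u))) *
      ((1 + v / (1 + u)) / (1 + u)) = kummer_kernel b (a - b) c u * gamma_kernel a c v"
proof -
  define x where "x = v / (1 + u)"
  have x: "0 < x" using assms by (simp add: x_def)
  have v: "v = x * (1 + u)" using assms by (simp add: x_def)
  have exp: "exp (- c * x) * exp (- c * (u * (1 + x))) = exp (- c * u) * exp (- c * v)"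
    unfolding v exp_add[symmetric] by (simp add: algebra_simps)
  have base: "z powr (r - 1) * z = z powr r" if "0 < z" for z r :: real
    using that by (simp add: powr_diff)
  have "x powr (a - 1) / (1 + x) powr b * (u * (1 + x)) powr (b - 1) * ((1 + x) / (1 + u)) =
      x powr (a - 1) * u powr (b - 1) * ((1 + x) powr (b - 1) * (1 + x)) / ((1 + x) powr b * (1 + u))"
    using assms x by (simp add: powr_mult)
  also have "\<dots> = x powr (a - 1) * u powr (b - 1) / (1 + u)"
    using x assms by (subst base) auto
  also have "\<dots> = u powr (b - 1) * (x powr (a - 1) * (1 + u) powr (a - 1)) / ((1 + u) powr (a - 1) * (1 + u))"
    using assms by simp
  also have "\<dots> = u powr (b - 1) / (1 + u) powr a * v powr (a - 1)"
    using x assms by (subst base) (auto simp: v powr_mult)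
  finally have "x powr (a - 1) / (1 + x) powr b * (u * (1 + x)) powr (b - 1) * ((1 + x) / (1 + u)) *
      (exp (- c * x) * exp (- c * (u * (1 + x)))) =
      u powr (b - 1) / (1 + u) powr a * v powr (a - 1) * (exp (- c * u) * exp (- c * v))"
    unfolding exp by simp
  then show ?thesis
    unfolding x_def[symmetric] kummer_kernel_def gamma_kernel_def using assms x by (simp add: ac_simps)
qed

text \<open>By the kernel identity the joint density is a constant times a product of kernels;
  integrating out one variable changes only the constant. The outcome has the shape of the
  hypothesis with \<open>a\<close> and \<open>b\<close> exchanged, so the lemma also serves for the
  inverse map.\<close>

lemma (in prob_space) kummer_gamma_transform:
  assumes indep: "indep_var borel X borel Y"
    and X: "has_law M X (kummer_distribution a (b - a) c)" and Y: "has_law M Y (gamma_distribution b c)"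
  shows "has_law M (\<lambda>\<omega>. Y \<omega> / (1 + X \<omega>)) (kummer_distribution b (a - b) c)"
    and "has_law M (\<lambda>\<omega>. X \<omega> * (1 + Y \<omega> / (1 + X \<omega>))) (gamma_distribution a c)"
proof -
  let ?U = "\<lambda>\<omega>. Y \<omega> / (1 + X \<omega>)" and ?V = "\<lambda>\<omega>. X \<omega> * (1 + Y \<omega> / (1 + X \<omega>))"
  obtain C1 C2 where
    DX: "distributed M lborel X (\<lambda>x. C1 * ennreal (kummer_kernel a (b - a) c x))" and
    DY: "distributed M lborel Y (\<lambda>y. C2 * ennreal (gamma_kernel b c y))"
    using has_law_normalised_measureD X Y kummer_kernel_nonneg gamma_kernel_nonneg
      kummer_kernel_measurable gamma_kernel_measurable
    unfolding kummer_distribution_def gamma_distribution_def by metis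
  let ?F = "\<lambda>x. C1 * ennreal (kummer_kernel a (b - a) c x)" and ?G = "\<lambda>y. C2 * ennreal (gamma_kernel b c y)"
  have "distributed M (lborel \<Otimes>\<^sub>M lborel) (\<lambda>\<omega>. (X \<omega>, Y \<omega>)) (\<lambda>(x, y). ?F x * ?G y)"
    using indep DX DY by (intro distributed_joint_indep) (auto simp: indep_var_lborel lborel.sigma_finite_measure_axioms)
  then have "distributed M (lborel \<Otimes>\<^sub>M lborel) (\<lambda>\<omega>. (?U \<omega>, ?V \<omega>))
    (\<lambda>(u, v). if 0 < u \<and> 0 < v then ?F (v / (1 + u)) * ?G (u * (1 + v / (1 + u))) *
      ennreal ((1 + v / (1 + u)) / (1 + u)) else 0)"
    by (rule distributed_change_of_variables) (auto simp: kummer_kernel_def gamma_kernel_def)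
  also have "(\<lambda>(u, v). if 0 < u \<and> 0 < v then ?F (v / (1 + u)) * ?G (u * (1 + v / (1 + u))) *
      ennreal ((1 + v / (1 + u)) / (1 + u)) else 0) =
    (\<lambda>(u, v). C1 * C2 * ennreal (kummer_kernel b (a - b) c u) * ennreal (gamma_kernel a c v))"
  proof (intro ext, clarsimp, intro conjI impI, goal_cases)
    case (1 u v)
    have "ennreal (kummer_kernel a (b - a) c (v / (1 + u))) * ennreal (gamma_kernel b c (u * (1 + v / (1 + u)))) *
      ennreal ((1 + v / (1 + u)) / (1 + u)) = ennreal (kummer_kernel b (a - b) c u) * ennreal (gamma_kernel a c v)"
      using kummer_gamma_kernel_identity[of u v a b c] 1
      by (simp add: ennreal_mult[symmetric] kummer_kernel_nonneg gamma_kernel_nonneg)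
    then show ?case
      by (simp only: mult.assoc mult.left_commute)
  next
    case (2 u v)
    then show ?case
      by (auto simp: kummer_kernel_def gamma_kernel_def)
  qed
  finally have D: "distributed M (lborel \<Otimes>\<^sub>M lborel) (\<lambda>\<omega>. (?U \<omega>, ?V \<omega>))
    (\<lambda>(u, v). C1 * C2 * ennreal (kummer_kernel b (a - b) c u) * ennreal (gamma_kernel a c v))" .
  have "distributed M lborel ?U (\<lambda>u. \<integral>\<^sup>+v. C1 * C2 * ennreal (kummer_kernel b (a - b) c u) * ennreal (gamma_kernel a c v) \<partial>lborel)"
    using distr_marginal1[OF _ _ D] lborel.sigma_finite_measure_axioms by simp
  then have "distributed M lborel ?U (\<lambda>u. (C1 * C2 * (\<integral>\<^sup>+v. ennreal (gamma_kernel a c v) \<partial>lborel)) * ennreal (kummer_kernel b (a - b) c u))"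
    by (subst (asm) nn_integral_cmult) (auto simp: mult.assoc mult.commute[of "nn_integral _ _"])
  then show "has_law M ?U (kummer_distribution b (a - b) c)"
    unfolding kummer_distribution_def
    by (rule has_law_normalised_measureI) (auto simp: kummer_kernel_nonneg)
  have "distributed M lborel ?V (\<lambda>v. \<integral>\<^sup>+u. C1 * C2 * ennreal (kummer_kernel b (a - b) c u) * ennreal (gamma_kernel a c v) \<partial>lborel)"
    using distr_marginal2[OF _ _ D] lborel.sigma_finite_measure_axioms by simp
  then have "distributed M lborel ?V (\<lambda>v. (C1 * C2 * (\<integral>\<^sup>+u. ennreal (kummer_kernel b (a - b) c u) \<partial>lborel)) * ennreal (gamma_kernel a c v))"
    by (simp add: nn_integral_cmult nn_integral_multc)
  then show "has_law M ?V (gamma_distribution a c)"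
    unfolding gamma_distribution_def
    by (rule has_law_normalised_measureI) (auto simp: gamma_kernel_nonneg)
qed

section \<open>The characterisation\<close>

text \<open>Supplies densities that vanish off the positive half-line, as the change of variables
  demands.\<close>

lemma (in prob_space) distributed_restrict:
  fixes \<phi> :: "real \<Rightarrow> ennreal"
  assumes D: "distributed M lborel X \<phi>" and "AE \<omega> in M. 0 < X \<omega>"
  shows "distributed M lborel X (\<lambda>x. \<phi> x * indicator {0<..} x)"
proof -
  have [measurable]: "\<phi> \<in> borel_measurable borel" "X \<in> borel_measurable M"
    using D by (auto simp: distributed_def)
  have "AE x in distr M lborel X. 0 < x"
    using assms(2) by (subst AE_distr_iff) auto
  then have "AE x in lborel. 0 < \<phi> x \<longrightarrow> 0 < x"
    unfolding distributed_distr_eq_density[OF D] by (subst (asm) AE_density) auto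
  then have "AE x in lborel. \<phi> x = \<phi> x * indicator {0<..} x"
    by eventually_elim (auto simp: indicator_def zero_less_iff_neq_zero)
  then show ?thesis
    using D by (subst (asm) distributed_cong_density) auto
qed

lemma (in prob_space) independent_transform_imp_kummer_gamma:
  fixes X Y :: "'a \<Rightarrow> real" and f g :: "real \<Rightarrow> real"
  assumes indep: "indep_var borel X borel Y"
    and pos: "AE \<omega> in M. 0 < X \<omega>" "AE \<omega> in M. 0 < Y \<omega>"
    and DX: "distributed M lborel X (\<lambda>x. ennreal (f x))" and DY: "distributed M lborel Y (\<lambda>y. ennreal (g y))"
    and f: "\<And>x. 0 < x \<Longrightarrow> 0 < f x" "f C1_differentiable_on {0<..}"
    and g: "\<And>y. 0 < y \<Longrightarrow> 0 < g y" "g C1_differentiable_on {0<..}"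
    and indep': "indep_var borel (\<lambda>\<omega>. Y \<omega> / (1 + X \<omega>)) borel (\<lambda>\<omega>. X \<omega> * (1 + Y \<omega> / (1 + X \<omega>)))"
  obtains a b c where "0 < a" "0 < b" "0 < c"
    and "has_law M X (kummer_distribution a (b - a) c)" and "has_law M Y (gamma_distribution b c)"
proof -
  let ?U = "\<lambda>\<omega>. Y \<omega> / (1 + X \<omega>)" and ?V = "\<lambda>\<omega>. X \<omega> * (1 + Y \<omega> / (1 + X \<omega>))"
  define F where "F x = ennreal (f x) * indicator {0<..} x" for x
  define G where "G y = ennreal (g y) * indicator {0<..} y" for y
  have DX': "distributed M lborel X F" and DY': "distributed M lborel Y G"
    unfolding F_def G_def using distributed_restrict DX DY pos by blast+
  have [measurable]: "F \<in> borel_measurable borel" "G \<in> borel_measurable borel"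
    using DX' DY' by (auto simp: distributed_def)
  have sigma_finite: "sigma_finite_measure (lborel :: real measure)"
    by (rule lborel.sigma_finite_measure_axioms)
  define h where "h u v = f (v / (1 + u)) * g (u * (1 + v / (1 + u))) * ((1 + v / (1 + u)) / (1 + u))" for u v
  let ?h = "\<lambda>(u, v). if 0 < u \<and> 0 < v then F (v / (1 + u)) * G (u * (1 + v / (1 + u))) *
      ennreal ((1 + v / (1 + u)) / (1 + u)) else 0"
  have "distributed M (lborel \<Otimes>\<^sub>M lborel) (\<lambda>\<omega>. (X \<omega>, Y \<omega>)) (\<lambda>(x, y). F x * G y)"
    using indep by (intro distributed_joint_indep sigma_finite DX' DY') (simp add: indep_var_lborel)
  then have D: "distributed M (lborel \<Otimes>\<^sub>M lborel) (\<lambda>\<omega>. (?U \<omega>, ?V \<omega>)) ?h"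
    by (rule distributed_change_of_variables) (measurable, simp_all add: F_def G_def)
  obtain p q where "distributed M lborel ?U p" "distributed M lborel ?V q"
    using distr_marginal1[OF sigma_finite sigma_finite D] distr_marginal2[OF sigma_finite sigma_finite D] by blast
  then have "distributed M (lborel \<Otimes>\<^sub>M lborel) (\<lambda>\<omega>. (?U \<omega>, ?V \<omega>)) (\<lambda>(u, v). p u * q v)"
    using indep' by (intro distributed_joint_indep sigma_finite) (simp_all add: indep_var_lborel)
  \<comment> \<open>The pair now has two joint densities, one from the change of variables and one
    from independence; they agree almost everywhere.\<close>
  from distributed_unique[OF D this]
  have AE: "AE z in lborel \<Otimes>\<^sub>M lborel. 0 < fst z \<longrightarrow> 0 < snd z \<longrightarrow>
      ennreal (h (fst z) (snd z)) = p (fst z) * q (snd z)"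
  proof eventually_elim
    case (elim z)
    show ?case
    proof (intro impI)
      assume z: "0 < fst z" "0 < snd z"
      obtain u v where uv: "z = (u, v)" by (cases z)
      have arg: "0 < v / (1 + u)" "0 < u * (1 + v / (1 + u))"
        using z uv by (auto intro!: mult_pos_pos add_pos_pos)
      have "0 \<le> f (v / (1 + u))" "0 \<le> g (u * (1 + v / (1 + u)))" "0 \<le> (1 + v / (1 + u)) / (1 + u)"
        using f(1)[OF arg(1)] g(1)[OF arg(2)] z uv by auto
      then have "ennreal (h u v) = ennreal (f (v / (1 + u))) * ennreal (g (u * (1 + v / (1 + u)))) *
          ennreal ((1 + v / (1 + u)) / (1 + u))"
        unfolding h_def by (simp only: ennreal_mult mult_nonneg_nonneg)
      also have "\<dots> = F (v / (1 + u)) * G (u * (1 + v / (1 + u))) * ennreal ((1 + v / (1 + u)) / (1 + u))"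
        using arg by (simp add: F_def G_def)
      finally have "ennreal (h u v) =
        F (v / (1 + u)) * G (u * (1 + v / (1 + u))) * ennreal ((1 + v / (1 + u)) / (1 + u))" .
      then show "ennreal (h (fst z) (snd z)) = p (fst z) * q (snd z)"
        using elim z uv by simp
    qed
  qed
  have cont: "continuous_on {0<..} f" "continuous_on {0<..} g"
    using f(2) g(2) C1_differentiable_imp_continuous_on by blast+
  have rank1: "h u v * h u' v' = h u v' * h u' v" if "0 < u" "0 < u'" "0 < v" "0 < v'" for u u' v v'
  proof (rule AE_product_imp_rank_one[OF _ _ _ AE that])
    show "0 < h u v" if "0 < u" "0 < v" for u v
      unfolding h_def using that by (intro mult_pos_pos divide_pos_pos f g add_pos_pos) auto
    show "continuous_on {0<..} (\<lambda>v. h u v)" if "0 < u" for u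
      unfolding h_def using that
      by (intro continuous_intros continuous_on_compose2[OF cont(1)] continuous_on_compose2[OF cont(2)])
        (auto intro!: mult_pos_pos add_pos_pos)
    show "continuous_on {0<..} (\<lambda>u. h u v)" if "0 < v" for v
      unfolding h_def using that
      by (intro continuous_intros continuous_on_compose2[OF cont(1)] continuous_on_compose2[OF cont(2)])
        (auto intro!: mult_pos_pos add_pos_pos)
  qed
  have "\<exists>a b c C1 C2. 0 < C1 \<and> 0 < C2 \<and> (\<forall>x>0. f x = C1 * kummer_kernel a (b - a) c x) \<and>
      (\<forall>y>0. g y = C2 * gamma_kernel b c y)"
    by (rule rank_one_imp_kummer_gamma) (fact f g h_def rank1)+
  then obtain a b c C1 C2 where C: "0 < C1" "0 < C2"
    and shape: "\<And>x. 0 < x \<Longrightarrow> f x = C1 * kummer_kernel a (b - a) c x"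
      "\<And>y. 0 < y \<Longrightarrow> g y = C2 * gamma_kernel b c y"
    by metis
  have "F = (\<lambda>x. ennreal C1 * ennreal (kummer_kernel a (b - a) c x))"
  proof
    show "F x = ennreal C1 * ennreal (kummer_kernel a (b - a) c x)" for x
      using C shape(1) by (cases "0 < x") (simp_all add: F_def ennreal_mult kummer_kernel_nonneg, simp add: kummer_kernel_def)
  qed
  with DX' have KX: "distributed M lborel X (\<lambda>x. ennreal C1 * ennreal (kummer_kernel a (b - a) c x))"
    by simp
  have "G = (\<lambda>y. ennreal C2 * ennreal (gamma_kernel b c y))"
  proof
    show "G y = ennreal C2 * ennreal (gamma_kernel b c y)" for y
      using C shape(2) by (cases "0 < y") (simp_all add: G_def ennreal_mult gamma_kernel_nonneg, simp add: gamma_kernel_def)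
  qed
  with DY' have GY: "distributed M lborel Y (\<lambda>y. ennreal C2 * ennreal (gamma_kernel b c y))"
    by simp
  \<comment> \<open>A nonzero constant times each integral is 1, so neither integral is
    infinite.\<close>
  have fin: "(\<integral>\<^sup>+x. ennreal (kummer_kernel a (b - a) c x) \<partial>lborel) \<noteq> \<top>"
    "(\<integral>\<^sup>+y. ennreal (gamma_kernel b c y) \<partial>lborel) \<noteq> \<top>"
    using nn_integral_scaled_density[OF KX] nn_integral_scaled_density[OF GY] C
    by (auto simp: ennreal_mult_top)
  show thesis
  proof (rule that[of a b c])
    show "0 < b" "0 < c"
      by (rule gamma_kernel_parameters_pos[OF fin(2)])+
    then show "0 < a"
      using kummer_kernel_parameter_pos[OF fin(1)] by blast
    show "has_law M X (kummer_distribution a (b - a) c)"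
      unfolding kummer_distribution_def
      by (rule has_law_normalised_measureI[OF KX]) (auto simp: kummer_kernel_nonneg)
    show "has_law M Y (gamma_distribution b c)"
      unfolding gamma_distribution_def
      by (rule has_law_normalised_measureI[OF GY]) (auto simp: gamma_kernel_nonneg)
  qed
qed

lemma has_law_cong_AE:
  assumes "has_law M X \<mu>" and [measurable]: "Y \<in> borel_measurable M" and "AE \<omega> in M. X \<omega> = Y \<omega>"
  shows "has_law M Y \<mu>"
proof -
  have [measurable]: "X \<in> borel_measurable M" and "distr M lborel X = \<mu>"
    using assms(1) by (auto simp: has_law_def)
  moreover have "distr M lborel X = distr M lborel Y"
    by (rule distr_cong_AE) (use assms(3) in auto)
  ultimately show ?thesis
    by (simp add: has_law_def)
qed

theorem theorem1:
  fixes M :: "'a measure" and X Y U V :: "'a \<Rightarrow> real" and f g :: "real \<Rightarrow> real"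
  assumes "prob_space M"
    and "prob_space.indep_var M borel X borel Y"
    and "AE \<omega> in M. 0 < X \<omega>" and "AE \<omega> in M. 0 < Y \<omega>"
    and "distributed M lborel X (\<lambda>x. ennreal (f x))"
    and "distributed M lborel Y (\<lambda>y. ennreal (g y))"
    and "\<And>x. 0 < x \<Longrightarrow> 0 < f x" and "\<And>y. 0 < y \<Longrightarrow> 0 < g y"
    and "f C1_differentiable_on {0<..}" and "g C1_differentiable_on {0<..}"
    and "U = (\<lambda>\<omega>. Y \<omega> / (1 + X \<omega>))"
    and "V = (\<lambda>\<omega>. X \<omega> * (1 + Y \<omega> / (1 + X \<omega>)))"
    and "prob_space.indep_var M borel U borel V"
  shows "(\<exists>a b c. 0 < a \<and> 0 < b \<and> 0 < c \<and>
            has_law M X (kummer_distribution a (b - a) c) \<and>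
            has_law M Y (gamma_distribution b c)) \<and>
         (\<forall>a b c. 0 < a \<longrightarrow> 0 < b \<longrightarrow> 0 < c \<longrightarrow>
            (has_law M X (kummer_distribution a (b - a) c) \<and>
             has_law M Y (gamma_distribution b c)
             \<longleftrightarrow>
             has_law M U (kummer_distribution b (a - b) c) \<and>
             has_law M V (gamma_distribution a c)))"
proof -
  interpret prob_space M by fact
  have [measurable]: "X \<in> borel_measurable M" "Y \<in> borel_measurable M"
    using assms(5,6) by (auto simp: distributed_def)
  \<comment> \<open>The map undoes itself only where \<open>X\<close> and \<open>Y\<close> are
    positive, hence almost everywhere; \<open>has_law_cong_AE\<close> bridges the gap.\<close>
  have involution: "AE \<omega> in M. V \<omega> / (1 + U \<omega>) = X \<omega> \<and> U \<omega> * (1 + V \<omega> / (1 + U \<omega>)) = Y \<omega>"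
    using assms(3,4)
  proof eventually_elim
    case (elim \<omega>)
    have "1 + U \<omega> > 0"
      unfolding assms(11) using elim by (simp add: add_pos_pos)
    then have "V \<omega> / (1 + U \<omega>) = X \<omega>"
      unfolding assms(11,12) by simp
    with elim show ?case
      unfolding assms(11) by simp
  qed
  \<comment> \<open>Since the map is an involution, the direct transform applied to the independent
    pair \<open>(U, V)\<close>, with \<open>a\<close> and \<open>b\<close> exchanged, yields the
    laws of \<open>X\<close> and \<open>Y\<close>.\<close>
  have "has_law M X (kummer_distribution a (b - a) c) \<and> has_law M Y (gamma_distribution b c)"
    if "has_law M U (kummer_distribution b (a - b) c)" "has_law M V (gamma_distribution a c)" for a b c
  proof
    show "has_law M X (kummer_distribution a (b - a) c)"
      by (rule has_law_cong_AE[OF kummer_gamma_transform(1)[OF assms(13) that]]) (use involution in auto)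
    show "has_law M Y (gamma_distribution b c)"
      by (rule has_law_cong_AE[OF kummer_gamma_transform(2)[OF assms(13) that]]) (use involution in auto)
  qed
  moreover have "has_law M U (kummer_distribution b (a - b) c) \<and> has_law M V (gamma_distribution a c)"
    if "has_law M X (kummer_distribution a (b - a) c)" "has_law M Y (gamma_distribution b c)" for a b c
    unfolding assms(11,12) using kummer_gamma_transform[OF assms(2) that] by blast
  moreover obtain a b c where "0 < a" "0 < b" "0 < c"
    "has_law M X (kummer_distribution a (b - a) c)" "has_law M Y (gamma_distribution b c)"
    using independent_transform_imp_kummer_gamma[OF assms(2-6) assms(7,9,8,10) assms(13)[unfolded assms(11,12)]]
    by blast
  ultimately show ?thesis
    by blast
qed

end
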